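(* In the two-walker linearly edge-reinforced random walk on the three-node segment with random walker selection, the random variables $$\frac{w(\tau_n,0)}{w(\tau_n,0)+w(\tau_n,1)},\qquad n\ge 0,$$ form a martingale.
   Context: Model (random walker selection): the graph is the segment with nodes $-1,0,1$ and edges $\{-1,0\}$ (left edge, weight $w(n,0)$ at time $n$) and $\{0,1\}$ (right edge, weight $w(n,1)$ at time $n$). Initially $w(0,0)=w(0,1)=1$. There are two walkers $X^{(1)},X^{(2)}$, both starting at node $0$. At every time step, one of the two walkers is chosen uniformly at random, independently of all other steps and of the past, and moves (the other stays): from node $-1$ or $1$ it moves back to node $0$; from node $0$, at time $n$, it moves to $-1$ with probability $\frac{w(n,0)}{w(n,0)+w(n,1)}$ and to $1$ with probability $\frac{w(n,1)}{w(n,0)+w(n,1)}$. The weight of the traversed edge is increased by $1$; the other weight is unchanged. Set $\tau_0=0$ and $\tau_n=\inf\{k>\tau_{n-1}: X^{(1)}_k=X^{(2)}_k=0\}$ for $n\ge 1$. *)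

theory Defs
  imports "HOL-Probability.Probability"
begin

text \<open>A configuration \<open>(x1, x2, a, b)\<close> consists of the positions of the two walkers and the
  weights of the left and of the right edge. A walker is always at \<open>-1\<close>, \<open>0\<close> or \<open>1\<close>; the last
  branch of \<open>walker_move\<close> serves the node \<open>1\<close>, and other positions are never reached.\<close>

type_synonym config = "int \<times> int \<times> nat \<times> nat"

definition walker_move :: "int \<Rightarrow> nat \<Rightarrow> nat \<Rightarrow> (int \<times> nat \<times> nat) pmf" where
  "walker_move x a b =
    (if x = 0 then
       map_pmf (\<lambda>left. if left then (-1, a + 1, b) else (1, a, b + 1))
         (bernoulli_pmf (real a / (real a + real b)))
     else if x = -1 then return_pmf (0, a + 1, b)
     else return_pmf (0, a, b + 1))"

fun lerrw_step :: "config \<Rightarrow> config pmf" where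
  "lerrw_step (x1, x2, a, b) =
    bind_pmf (bernoulli_pmf (1/2)) (\<lambda>first.
      if first then map_pmf (\<lambda>(y, a', b'). (y, x2, a', b')) (walker_move x1 a b)
      else map_pmf (\<lambda>(y, a', b'). (x1, y, a', b')) (walker_move x2 a b))"

definition lerrw_config ::
  "(nat \<Rightarrow> 'a \<Rightarrow> int) \<Rightarrow> (nat \<Rightarrow> 'a \<Rightarrow> int) \<Rightarrow> (nat \<Rightarrow> nat \<Rightarrow> 'a \<Rightarrow> nat) \<Rightarrow> nat \<Rightarrow> 'a \<Rightarrow> config" where
  "lerrw_config X1 X2 w n \<omega> = (X1 n \<omega>, X2 n \<omega>, w n 0 \<omega>, w n 1 \<omega>)"

text \<open>\<open>w n 0\<close> and \<open>w n 1\<close> are the weights at time \<open>n\<close>; the values \<open>w n e\<close> for \<open>e \<ge> 2\<close> are not used.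
  The last assumption says that, given the whole past up to time \<open>n\<close>, the configuration at time
  \<open>n + 1\<close> has law \<open>lerrw_step\<close> of the current one. It is written without division, so that
  histories of probability zero need no separate treatment.\<close>

locale two_walker_lerrw = prob_space M for M :: "'a measure" +
  fixes X1 X2 :: "nat \<Rightarrow> 'a \<Rightarrow> int" and w :: "nat \<Rightarrow> nat \<Rightarrow> 'a \<Rightarrow> nat"
  assumes measurable_config: "\<And>n. lerrw_config X1 X2 w n \<in> M \<rightarrow>\<^sub>M count_space UNIV"
    and initial_config: "AE \<omega> in M. lerrw_config X1 X2 w 0 \<omega> = (0, 0, 1, 1)"
    and config_step: "\<And>n h s.
      prob {\<omega> \<in> space M. (\<forall>k\<le>n. lerrw_config X1 X2 w k \<omega> = h k) \<and> lerrw_config X1 X2 w (Suc n) \<omega> = s}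
      = prob {\<omega> \<in> space M. \<forall>k\<le>n. lerrw_config X1 X2 w k \<omega> = h k} * pmf (lerrw_step (h n)) s"

primrec meeting_time ::
  "(nat \<Rightarrow> 'a \<Rightarrow> int) \<Rightarrow> (nat \<Rightarrow> 'a \<Rightarrow> int) \<Rightarrow> nat \<Rightarrow> 'a \<Rightarrow> enat" where
  "meeting_time X1 X2 0 \<omega> = 0"
| "meeting_time X1 X2 (Suc n) \<omega> =
    (INF k\<in>{k. enat k > meeting_time X1 X2 n \<omega> \<and> X1 k \<omega> = 0 \<and> X2 k \<omega> = 0}. enat k)"

text \<open>The infimum of the empty set is \<open>\<infinity>\<close>. In \<open>two_walker_lerrw\<close> the meeting times are almost
  surely finite, so the value chosen at \<open>\<infinity>\<close> below is immaterial.\<close>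

definition left_fraction_at_meeting ::
  "(nat \<Rightarrow> 'a \<Rightarrow> int) \<Rightarrow> (nat \<Rightarrow> 'a \<Rightarrow> int) \<Rightarrow> (nat \<Rightarrow> nat \<Rightarrow> 'a \<Rightarrow> nat) \<Rightarrow> nat \<Rightarrow> 'a \<Rightarrow> real" where
  "left_fraction_at_meeting X1 X2 w n \<omega> =
    (case meeting_time X1 X2 n \<omega> of
       enat t \<Rightarrow> real (w t 0 \<omega>) / (real (w t 0 \<omega>) + real (w t 1 \<omega>))
     | \<infinity> \<Rightarrow> 0)"

definition martingale_wrt :: "'a measure \<Rightarrow> (nat \<Rightarrow> 'a measure) \<Rightarrow> (nat \<Rightarrow> 'a \<Rightarrow> real) \<Rightarrow> bool" where
  "martingale_wrt M F Y \<longleftrightarrow>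
    filtration (space M) F \<and> (\<forall>n. subalgebra M (F n)) \<and>
    (\<forall>n. Y n \<in> borel_measurable (F n)) \<and> (\<forall>n. integrable M (Y n)) \<and>
    (\<forall>m n. m \<le> n \<longrightarrow> (AE \<omega> in M. real_cond_exp M (F m) (Y n) \<omega> = Y m \<omega>))"

definition natural_filtration :: "'a measure \<Rightarrow> (nat \<Rightarrow> 'a \<Rightarrow> real) \<Rightarrow> nat \<Rightarrow> 'a measure" where
  "natural_filtration M Y n =
    sigma (space M) {Y i -` B \<inter> space M | i B. i \<le> n \<and> B \<in> sets borel}"

definition martingale :: "'a measure \<Rightarrow> (nat \<Rightarrow> 'a \<Rightarrow> real) \<Rightarrow> bool" where
  "martingale M Y \<longleftrightarrow> martingale_wrt M (natural_filtration M Y) Y"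

end

theory Submission
  imports Defs
begin

text \<open>The fraction at the meeting times is a martingale because it extends to a bounded function
  \<open>h\<close> of the configuration that is harmonic for \<open>lerrw_step\<close> and equals the fraction of the left
  edge whenever both walkers are at \<open>0\<close>. Such an \<open>h\<close> exists because the number of steps of an
  excursion between meetings does not depend on the directions taken, and, given that number, the
  expected final left weight is linear in the current left weight and in the number of walkers at
  \<open>-1\<close>. At every odd time exactly one walker is away from \<open>0\<close>, and with probability \<open>1/2\<close> it
  returns at once, so the meeting times are almost surely finite. Optional stopping for the bounded
  process \<open>h\<close> then gives the claim.\<close>

section \<open>A harmonic function of the configuration\<close>

text \<open>With total weight \<open>N\<close>, left weight \<open>a\<close> and one walker away from \<open>0\<close>, the expected fraction
  at the next meeting is \<open>\<alpha> N * a\<close>, plus \<open>\<beta> N\<close> if this walker is at \<open>-1\<close>. Conditioning on the next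
  two steps gives \<open>\<alpha> N * N + \<beta> N = 1\<close> and the recursion of lemma \<open>meeting_coeff_rec\<close> for \<open>\<beta>\<close>, in
  which \<open>\<beta> N\<close> depends on \<open>\<beta> (N + 2)\<close>; \<open>\<beta>\<close> is obtained as the limit of its iterates from \<open>0\<close>.
  With both walkers away, the value is the average over which of them returns first, at total
  weight \<open>N + 1\<close>.\<close>

primrec meeting_coeff_approx :: "nat \<Rightarrow> nat \<Rightarrow> real" where
  "meeting_coeff_approx 0 N = 0"
| "meeting_coeff_approx (Suc k) N =
    1 / (2 * (real N + 1)) +
    ((1 - meeting_coeff_approx k (N + 2)) / (real N + 2) + meeting_coeff_approx k (N + 2)) / 4"

text \<open>In this form an iterate is a positive constant plus a slope between 0 and 1/4 times the
  previous iterate at \<open>N + 2\<close>; sign, upper bound and monotonicity can be read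
  off.\<close>

lemma meeting_coeff_approx_Suc:
  "meeting_coeff_approx (Suc k) N = 1 / (2 * (real N + 1)) + 1 / (4 * (real N + 2))
    + (1 - 1 / (real N + 2)) / 4 * meeting_coeff_approx k (N + 2)"
proof -
  have "((1 - y) / x + y) / 4 = 1 / (4 * x) + (1 - 1 / x) / 4 * y" if "x > 0" for x y :: real
    using that by (simp add: field_simps)
  from this[of "real N + 2"] show ?thesis
    unfolding meeting_coeff_approx.simps by (simp only: add_pos_pos of_nat_0_le_iff add_nonneg_pos zero_less_numeral add.assoc)
qed

lemma meeting_coeff_approx_nonneg: "0 \<le> meeting_coeff_approx k N"
  by (induction k arbitrary: N)
    (auto simp only: meeting_coeff_approx_Suc meeting_coeff_approx.simps(1)
      intro!: add_nonneg_nonneg mult_nonneg_nonneg; simp add: field_simps)+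

lemma meeting_coeff_approx_le_1: "meeting_coeff_approx k N \<le> 1"
proof (induction k arbitrary: N)
  case (Suc k)
  \<comment> \<open>The three summands contribute at most 1/2, 1/4 and 1/4, in total exactly
    1.\<close>
  have "1 / (2 * (real N + 1)) \<le> 1 / 2" "1 / (4 * (real N + 2)) \<le> 1 / 4"
    by (simp_all add: field_simps)
  moreover have "(1 - 1 / (real N + 2)) / 4 * meeting_coeff_approx k (N + 2) \<le> 1 / 4 * 1"
    by (rule mult_mono) (use Suc meeting_coeff_approx_nonneg in \<open>auto simp: field_simps\<close>)
  ultimately show ?case
    by (simp only: meeting_coeff_approx_Suc)
qed simp

lemma meeting_coeff_approx_mono: "meeting_coeff_approx k N \<le> meeting_coeff_approx (Suc k) N"
proof (induction k arbitrary: N)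
  case 0
  then show ?case
    using meeting_coeff_approx_nonneg[of "Suc 0" N] by simp
next
  case (Suc k)
  show ?case
    unfolding meeting_coeff_approx_Suc[of "Suc k"] meeting_coeff_approx_Suc[of k N]
    by (intro add_left_mono mult_left_mono Suc) (simp add: field_simps)
qed

definition meeting_coeff :: "nat \<Rightarrow> real" where
  "meeting_coeff N = lim (\<lambda>k. meeting_coeff_approx k N)"

lemma meeting_coeff_LIMSEQ: "(\<lambda>k. meeting_coeff_approx k N) \<longlonglongrightarrow> meeting_coeff N"
proof -
  have "Bseq (\<lambda>k. meeting_coeff_approx k N)"
    using meeting_coeff_approx_nonneg meeting_coeff_approx_le_1
    by (intro BseqI'[where K = 1]) (simp add: abs_le_iff order_trans[OF _ zero_le_one])
  moreover have "incseq (\<lambda>k. meeting_coeff_approx k N)"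
    by (rule incseq_SucI) (rule meeting_coeff_approx_mono)
  ultimately show ?thesis
    unfolding meeting_coeff_def
    by (intro convergent_LIMSEQ_iff[THEN iffD1] Bseq_mono_convergent) (auto simp: incseq_def)
qed

text \<open>This is the limit of the iteration. With probability 1/2 the absent walker returns at
  once and, if it was at \<open>-1\<close>, contributes 1 to a total of \<open>N + 1\<close>.
  Otherwise the other walker leaves too; the factor 1/4 is this 1/2 times the average over which of
  the two returns first, at total weight \<open>N + 2\<close>.\<close>

lemma meeting_coeff_rec:
  "meeting_coeff N = 1 / (2 * (real N + 1)) +
    ((1 - meeting_coeff (N + 2)) / (real N + 2) + meeting_coeff (N + 2)) / 4"
proof (rule LIMSEQ_unique)
  show "(\<lambda>k. meeting_coeff_approx (Suc k) N) \<longlonglongrightarrow> meeting_coeff N"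
    by (rule LIMSEQ_Suc[OF meeting_coeff_LIMSEQ])
  show "(\<lambda>k. meeting_coeff_approx (Suc k) N) \<longlonglongrightarrow> 1 / (2 * (real N + 1)) +
    ((1 - meeting_coeff (N + 2)) / (real N + 2) + meeting_coeff (N + 2)) / 4"
    unfolding meeting_coeff_approx.simps by (intro tendsto_intros meeting_coeff_LIMSEQ) auto
qed

lemma meeting_coeff_bounds: "0 \<le> meeting_coeff N" "meeting_coeff N \<le> 1"
  using meeting_coeff_approx_nonneg meeting_coeff_approx_le_1
  by (auto intro: LIMSEQ_le_const[OF meeting_coeff_LIMSEQ] LIMSEQ_le_const2[OF meeting_coeff_LIMSEQ])

text \<open>A walker at \<open>-1\<close> must come back over the left edge, so this counts a left
  traversal that is already certain.\<close>

definition walkers_left :: "int \<Rightarrow> real" where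
  "walkers_left x = (if x = -1 then 1 else 0)"

fun meeting_value :: "config \<Rightarrow> real" where
  "meeting_value (x1, x2, a, b) =
    (let N = a + b; \<beta> = meeting_coeff; \<alpha> = (\<lambda>N. (1 - \<beta> N) / real N);
         l = walkers_left x1 + walkers_left x2
     in if x1 = 0 \<and> x2 = 0 then real a / real N
        else if x1 = 0 \<or> x2 = 0 then \<alpha> N * real a + \<beta> N * l
        else \<alpha> (N + 1) * real a + (\<alpha> (N + 1) + \<beta> (N + 1)) / 2 * l)"

text \<open>The term in the left weight is at most 1, and the two walkers add at most 1 each, their
  coefficient lying in the unit interval. Uniformity over all configurations later permits dominated
  convergence.\<close>

lemma meeting_value_bounded: "\<bar>meeting_value s\<bar> \<le> 3"
proof -
  obtain x1 x2 a b where s: "s = (x1, x2, a, b)"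
    by (cases s)
  have \<alpha>: "0 \<le> (1 - meeting_coeff N) / real N" "(1 - meeting_coeff N) / real N \<le> 1" for N
    using meeting_coeff_bounds[of N] by (cases N; simp add: field_simps)+
  have \<alpha>': "0 \<le> (1 - meeting_coeff N) / real N * real a \<and> (1 - meeting_coeff N) / real N * real a \<le> 1"
    if "a \<le> N" for N
  proof (cases "N = 0")
    case False
    have "(1 - meeting_coeff N) * real a \<le> 1 * real N"
      using that meeting_coeff_bounds[of N] by (intro mult_mono) auto
    with False show ?thesis
      using meeting_coeff_bounds[of N] by (simp add: divide_le_eq_1)
  qed simp
  have l: "0 \<le> walkers_left x1 + walkers_left x2" "walkers_left x1 + walkers_left x2 \<le> 2"
    by (auto simp: walkers_left_def)
  have "0 \<le> meeting_coeff (a + b) * (walkers_left x1 + walkers_left x2)"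
    "meeting_coeff (a + b) * (walkers_left x1 + walkers_left x2) \<le> 1 * 2"
    using l meeting_coeff_bounds by (intro mult_nonneg_nonneg mult_mono; simp)+
  moreover define \<gamma> where
    "\<gamma> = ((1 - meeting_coeff (a + b + 1)) / real (a + b + 1) + meeting_coeff (a + b + 1)) / 2"
  have "0 \<le> \<gamma>" "\<gamma> \<le> 1"
    unfolding \<gamma>_def
    using add_mono[OF \<alpha>(2) meeting_coeff_bounds(2), of "a + b + 1" "a + b + 1"]
      add_nonneg_nonneg[OF \<alpha>(1) meeting_coeff_bounds(1), of "a + b + 1" "a + b + 1"]
    by (simp_all del: of_nat_add of_nat_Suc)
  then have "0 \<le> \<gamma> * (walkers_left x1 + walkers_left x2)"
    "\<gamma> * (walkers_left x1 + walkers_left x2) \<le> 1 * 2"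
    using l by (intro mult_nonneg_nonneg mult_mono; simp)+
  moreover have "0 \<le> real a / real (a + b)" "real a / real (a + b) \<le> 1"
    by (auto simp: divide_le_eq_1)
  ultimately show ?thesis
    using \<alpha>'[OF le_add1, of b] \<alpha>'[OF order_trans[OF le_add1 le_add1], of b 1]
    unfolding s meeting_value.simps Let_def \<gamma>_def[symmetric]
    by (simp only: abs_le_iff split: if_split; intro conjI impI; linarith)
qed

section \<open>Expectations over one step, and harmonicity\<close>

lemma expectation_bind_pmf_finite:
  fixes h :: "'b \<Rightarrow> real"
  assumes "finite (set_pmf p)" "\<And>x. x \<in> set_pmf p \<Longrightarrow> finite (set_pmf (f x))"
  shows "measure_pmf.expectation (bind_pmf p f) h =
    measure_pmf.expectation p (\<lambda>x. measure_pmf.expectation (f x) h)"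
  using assms by (simp add: pmf_expectation_bind[of "set_pmf p"] integral_measure_pmf[of "set_pmf p"])

lemma finite_set_walker_move: "finite (set_pmf (walker_move x a b))"
  by (simp add: walker_move_def)

lemma finite_set_lerrw_step: "finite (set_pmf (lerrw_step s))"
  by (cases s) (auto simp: finite_set_walker_move)

lemma expectation_walker_move:
  "measure_pmf.expectation (walker_move x a b) g =
    (if x = 0 then real a / real (a + b) * g (-1, a + 1, b)
        + (1 - real a / real (a + b)) * g (1, a, b + 1)
     else if x = -1 then g (0, a + 1, b) else g (0, a, b + 1))"
proof -
  \<comment> \<open>\<open>bernoulli_pmf\<close> clips its parameter to the unit interval, so the
    parameter has to be seen to lie there.\<close>
  have "real a / (real a + real b) \<le> 1"
    by (simp add: divide_le_eq_1 less_le)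
  then show ?thesis
    by (simp add: walker_move_def mult.commute)
qed

lemma expectation_lerrw_step:
  fixes g :: "config \<Rightarrow> real"
  shows "measure_pmf.expectation (lerrw_step (x1, x2, a, b)) g =
    (measure_pmf.expectation (walker_move x1 a b) (\<lambda>(y, a', b'). g (y, x2, a', b'))
     + measure_pmf.expectation (walker_move x2 a b) (\<lambda>(y, a', b'). g (x1, y, a', b'))) / 2"
  by (simp add: expectation_bind_pmf_finite finite_set_walker_move case_prod_beta' add_divide_distrib)

text \<open>With both walkers at 0 this follows from \<open>\<alpha> N * N + \<beta> N = 1\<close>
  at total weight \<open>N + 1\<close>; with one away it is the recursion for \<beta>; with both
  away it is the average built into \<open>meeting_value\<close>.\<close>

lemma meeting_value_harmonic:
  assumes "a + b > 0"
  shows "measure_pmf.expectation (lerrw_step (x1, x2, a, b)) meeting_value =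
    meeting_value (x1, x2, a, b)"
proof -
  define N where "N = real a + real b"
  have N: "N > 0"
    using assms unfolding N_def by (metis of_nat_0_less_iff of_nat_add)
  have b: "real b = N - real a"
    by (simp add: N_def)
  define B where "B = meeting_coeff (Suc (Suc (a + b)))"
  have rec: "meeting_coeff (a + b) = 1 / (2 * (N + 1)) + ((1 - B) / (N + 2) + B) / 4"
    using meeting_coeff_rec[of "a + b"] by (simp add: N_def B_def)
  consider "x1 = 0" "x2 = 0" | "x1 = 0" "x2 \<noteq> 0" | "x1 \<noteq> 0" "x2 = 0" | "x1 \<noteq> 0" "x2 \<noteq> 0"
    by blast
  then show ?thesis
  proof cases
    case 1
    then show ?thesis
      using N unfolding expectation_lerrw_step by (simp add: expectation_walker_move Let_def
          walkers_left_def b add.assoc) (simp add: divide_simps, simp add: algebra_simps)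
  next
    case 2
    then show ?thesis
      using N unfolding expectation_lerrw_step by (simp add: expectation_walker_move Let_def
          walkers_left_def b add.assoc rec B_def[symmetric]) (simp add: divide_simps, simp add: algebra_simps)
  next
    case 3
    then show ?thesis
      using N unfolding expectation_lerrw_step by (simp add: expectation_walker_move Let_def
          walkers_left_def b add.assoc rec B_def[symmetric]) (simp add: divide_simps, simp add: algebra_simps)
  next
    case 4
    then show ?thesis
      using N unfolding expectation_lerrw_step by (simp add: expectation_walker_move Let_def
          walkers_left_def b add.assoc) (simp add: divide_simps, simp add: algebra_simps)
  qed
qed

section \<open>Meeting times\<close>

lemma meeting_time_Suc_eq_enat_iff:
  "meeting_time X1 X2 (Suc m) \<omega> = enat k \<longleftrightarrow>
    meeting_time X1 X2 m \<omega> < enat k \<and> X1 k \<omega> = 0 \<and> X2 k \<omega> = 0 \<and>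
    (\<forall>j<k. \<not> (meeting_time X1 X2 m \<omega> < enat j \<and> X1 j \<omega> = 0 \<and> X2 j \<omega> = 0))"
    (is "?l = enat k \<longleftrightarrow> ?P k \<and> ?Q k \<and> ?R k \<and> ?Z")
proof -
  define K where "K = {k. ?P k \<and> ?Q k \<and> ?R k}"
  have l: "?l = (INF k\<in>K. enat k)"
    by (simp add: K_def)
  show ?thesis
  proof
    assume k: "?l = enat k"
    \<comment> \<open>The infimum of the empty set is infinity, so \<open>K\<close> is nonempty, and
      by well-ordering the infimum is attained.\<close>
    then have "K \<noteq> {}"
      unfolding l by (auto simp: top_enat_def)
    then have "enat k \<in> enat ` K"
      using k unfolding l by (metis image_is_empty ex_in_conv wellorder_InfI)
    moreover have "k \<le> j" if "j \<in> K" for j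
      using INF_lower[OF that, of enat] k unfolding l by simp
    ultimately show "?P k \<and> ?Q k \<and> ?R k \<and> ?Z"
      by (force simp: K_def)
  next
    assume *: "?P k \<and> ?Q k \<and> ?R k \<and> ?Z"
    show "?l = enat k"
      unfolding l
    proof (rule antisym)
      show "(INF k\<in>K. enat k) \<le> enat k"
        using * by (intro INF_lower) (simp add: K_def)
      show "enat k \<le> (INF k\<in>K. enat k)"
        using * by (intro INF_greatest) (force simp: K_def not_less[symmetric])
    qed
  qed
qed

lemma meeting_time_mono: "m \<le> n \<Longrightarrow> meeting_time X1 X2 m \<omega> \<le> meeting_time X1 X2 n \<omega>"
  by (rule lift_Suc_mono_le[where f = "\<lambda>n. meeting_time X1 X2 n \<omega>"])
    (auto intro!: INF_greatest simp: less_imp_le)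

text \<open>This is the stopping time property, path by path. The previous meeting is strictly
  earlier, so the induction hypothesis transfers it first.\<close>

lemma meeting_time_cong:
  assumes "meeting_time X1 X2 m \<omega> = enat t" "t \<le> n"
    and "\<And>k. k \<le> n \<Longrightarrow> X1 k \<omega> = X1 k \<omega>' \<and> X2 k \<omega> = X2 k \<omega>'"
  shows "meeting_time X1 X2 m \<omega>' = enat t"
  using assms(1,2)
proof (induction m arbitrary: t)
  case (Suc m)
  from Suc.prems(1) have *: "meeting_time X1 X2 m \<omega> < enat t" "X1 t \<omega> = 0" "X2 t \<omega> = 0"
    "\<And>j. j < t \<Longrightarrow> \<not> (meeting_time X1 X2 m \<omega> < enat j \<and> X1 j \<omega> = 0 \<and> X2 j \<omega> = 0)"
    unfolding meeting_time_Suc_eq_enat_iff by auto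
  from *(1) obtain u where u: "meeting_time X1 X2 m \<omega> = enat u" "u < t"
    by (cases "meeting_time X1 X2 m \<omega>") auto
  then have "meeting_time X1 X2 m \<omega>' = enat u"
    using Suc.IH Suc.prems(2) by simp
  then show ?case
    using * u Suc.prems(2) assms(3) unfolding meeting_time_Suc_eq_enat_iff
    by (metis less_imp_le order_trans)
qed simp

lemma meeting_time_finite:
  assumes "\<And>k. \<exists>j>k. X1 j \<omega> = 0 \<and> X2 j \<omega> = 0"
  shows "meeting_time X1 X2 n \<omega> \<noteq> \<infinity>"
proof (induction n)
  case (Suc n)
  then obtain t where t: "meeting_time X1 X2 n \<omega> = enat t"
    by auto
  obtain j where "j > t" "X1 j \<omega> = 0" "X2 j \<omega> = 0"
    using assms by blast
  then have "meeting_time X1 X2 (Suc n) \<omega> \<le> enat j"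
    using t by (auto intro!: INF_lower)
  then show ?case
    by (metis enat_ord_simps(5) infinity_ileE)
qed simp

lemma meeting_time_meets:
  assumes "meeting_time X1 X2 n \<omega> = enat t" "X1 0 \<omega> = 0" "X2 0 \<omega> = 0"
  shows "X1 t \<omega> = 0 \<and> X2 t \<omega> = 0"
proof (cases n)
  case 0
  then show ?thesis
    using assms by (simp add: zero_enat_def)
next
  case (Suc m)
  then show ?thesis
    using assms(1) meeting_time_Suc_eq_enat_iff[of X1 X2 m \<omega> t] by simp
qed

section \<open>The Markov property\<close>

text \<open>Lists of configurations form a countable type, so laws on them are determined by
  singletons. With the latest entry first, the current configuration is the head and the past is the
  tail.\<close>

primrec history :: "(nat \<Rightarrow> 'a \<Rightarrow> 'b) \<Rightarrow> nat \<Rightarrow> 'a \<Rightarrow> 'b list" where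
  "history C 0 \<omega> = [C 0 \<omega>]"
| "history C (Suc n) \<omega> = C (Suc n) \<omega> # history C n \<omega>"

lemma history_eq_iff: "history C n \<omega> = history C n \<omega>' \<longleftrightarrow> (\<forall>k\<le>n. C k \<omega> = C k \<omega>')"
  by (induction n) (auto simp: le_Suc_eq)

lemma hd_history [simp]: "hd (history C n \<omega>) = C n \<omega>"
  by (cases n) auto

primrec history_pmf :: "nat \<Rightarrow> config list pmf" where
  "history_pmf 0 = return_pmf [(0, 0, 1, 1)]"
| "history_pmf (Suc n) =
    bind_pmf (history_pmf n) (\<lambda>l. map_pmf (\<lambda>s. s # l) (lerrw_step (hd l)))"

lemma finite_set_history_pmf: "finite (set_pmf (history_pmf n))"
  by (induction n) (auto simp: finite_set_lerrw_step)

lemma pmf_map_Cons: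
  "pmf (map_pmf (\<lambda>s. s # l) q) (s # l') = (if l = l' then pmf q s else 0)"
proof (cases "l = l'")
  case True
  then show ?thesis
    using pmf_map_inj'[of "\<lambda>s. s # l" q s] by (simp add: inj_def)
next
  case False
  then have "s # l' \<notin> set_pmf (map_pmf (\<lambda>s. s # l) q)"
    by auto
  with False show ?thesis
    by (simp only: pmf_eq_0_set_pmf if_False not_False_eq_True)
qed

text \<open>Each step toggles exactly one walker between being at 0 and being away, so the parity of
  the time is that of the number of walkers away. Positive total weight is what
  \<open>meeting_value_harmonic\<close> asks for.\<close>

fun walkers_invariant :: "nat \<Rightarrow> config \<Rightarrow> bool" where
  "walkers_invariant n (x1, x2, a, b) \<longleftrightarrow> a + b > 0 \<and> (even n \<longleftrightarrow> (x1 = 0 \<longleftrightarrow> x2 = 0))"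

lemma walker_move_invariant:
  assumes "(y, a', b') \<in> set_pmf (walker_move x a b)"
  shows "a' + b' = a + b + 1" "y = 0 \<longleftrightarrow> x \<noteq> 0"
  using assms by (auto simp: walker_move_def split: if_splits)

lemma walkers_invariant_step:
  assumes "walkers_invariant n s" "s' \<in> set_pmf (lerrw_step s)"
  shows "walkers_invariant (Suc n) s'"
proof -
  obtain x1 x2 a b where s: "s = (x1, x2, a, b)"
    by (cases s)
  from assms(2) consider
    y a' b' where "(y, a', b') \<in> set_pmf (walker_move x1 a b)" "s' = (y, x2, a', b')"
    | y a' b' where "(y, a', b') \<in> set_pmf (walker_move x2 a b)" "s' = (x1, y, a', b')"
    unfolding s lerrw_step.simps set_bind_pmf by (auto split: if_splits)
  then show ?thesis
    using assms(1) walker_move_invariant unfolding s by cases fastforce+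
qed

lemma history_pmf_invariant: "l \<in> set_pmf (history_pmf n) \<Longrightarrow> walkers_invariant n (hd l)"
proof (induction n arbitrary: l)
  case (Suc n)
  from Suc.prems obtain l' s where l: "l' \<in> set_pmf (history_pmf n)"
    "s \<in> set_pmf (lerrw_step (hd l'))" "l = s # l'"
    unfolding history_pmf.simps set_bind_pmf set_map_pmf by blast
  then show ?case
    using walkers_invariant_step[OF Suc.IH[OF l(1)] l(2)] by simp
qed simp

section \<open>The law of the trajectory up to a fixed time\<close>

context two_walker_lerrw
begin

abbreviation "C \<equiv> lerrw_config X1 X2 w"

lemma measurable_C [measurable]: "C n \<in> M \<rightarrow>\<^sub>M count_space UNIV"
  by (rule measurable_config)

lemma measurable_history [measurable]: "history C n \<in> M \<rightarrow>\<^sub>M count_space UNIV"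
proof (induction n)
  case (Suc n)
  have "(\<lambda>\<omega>. (\<lambda>(s, l). s # l) (C (Suc n) \<omega>, history C n \<omega>)) \<in> M \<rightarrow>\<^sub>M count_space UNIV"
    using Suc by measurable
  then show ?case
    by (simp add: history.simps(2)[abs_def])
qed (simp add: history.simps(1)[abs_def])

lemma prob_history_Cons:
  "prob {\<omega> \<in> space M. history C (Suc n) \<omega> = s # l} =
    prob {\<omega> \<in> space M. history C n \<omega> = l} * pmf (lerrw_step (hd l)) s"
\<comment> \<open>The path of \<open>\<omega>0\<close> serves as the function \<open>h\<close> in
  \<open>config_step\<close>; for a list that is no history both sides are 0.\<close>
proof (cases "\<exists>\<omega>0. history C n \<omega>0 = l")
  case True
  then obtain \<omega>0 where l: "history C n \<omega>0 = l"
    by blast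
  show ?thesis
    using config_step[of n "\<lambda>k. C k \<omega>0" s] history_eq_iff[of C n _ \<omega>0]
    unfolding l[symmetric] by (simp add: conj_commute)
qed auto

lemma prob_history: "prob {\<omega> \<in> space M. history C n \<omega> = l} = pmf (history_pmf n) l"
proof (induction n arbitrary: l)
  case 0
  have "AE \<omega> in M. history C 0 \<omega> = [(0, 0, 1, 1)]"
    using initial_config by simp
  then have "prob {\<omega> \<in> space M. history C 0 \<omega> = l} = prob {\<omega> \<in> space M. [(0, 0, 1, 1)] = l}"
    by (intro finite_measure_eq_AE) auto
  then show ?case
    by (cases "l = [(0, 0, 1, 1)]") (simp_all add: prob_space eq_commute[of _ l])
next
  case (Suc n)
  show ?case
  proof (cases l)
    case Nil
    have "[] \<notin> set_pmf (history_pmf (Suc n))"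
      by auto
    then have "pmf (history_pmf (Suc n)) [] = 0"
      by (simp only: pmf_eq_0_set_pmf not_False_eq_True)
    with Nil show ?thesis
      by simp
  next
    case (Cons s l')
    \<comment> \<open>Only the history \<open>l'\<close> can be extended to \<open>s # l'\<close>,
      so the integral reduces to one point mass.\<close>
    have "pmf (history_pmf (Suc n)) l =
        (\<integral>l0. indicator {l'} l0 * pmf (lerrw_step (hd l')) s \<partial>history_pmf n)"
      unfolding Cons history_pmf.simps pmf_bind pmf_map_Cons
      by (intro Bochner_Integration.integral_cong) (auto simp: indicator_def)
    then show ?thesis
      unfolding Cons prob_history_Cons Suc by (simp add: measure_pmf_single)
  qed
qed

lemma distr_history: "distr M (count_space UNIV) (history C n) = measure_pmf (history_pmf n)"
proof (rule measure_eqI_countable[where A = UNIV])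
  show "emeasure (distr M (count_space UNIV) (history C n)) {l} = emeasure (history_pmf n) {l}" for l
    using prob_history[of n l]
    by (simp add: emeasure_distr emeasure_pmf_single vimage_def Int_def conj_commute
        emeasure_eq_measure)
qed auto

lemma expectation_history:
  fixes f :: "config list \<Rightarrow> real"
  shows "expectation (\<lambda>\<omega>. f (history C n \<omega>)) = measure_pmf.expectation (history_pmf n) f"
  unfolding distr_history[symmetric] by (subst integral_distr) auto

lemma AE_invariant: "AE \<omega> in M. walkers_invariant n (C n \<omega>)"
proof -
  have "AE l in distr M (count_space UNIV) (history C n). walkers_invariant n (hd l)"
    unfolding distr_history by (simp add: AE_measure_pmf_iff history_pmf_invariant)
  then show ?thesis
    by (subst (asm) AE_distr_iff) auto
qed

text \<open>The history has a finitely supported law, so both sides are finite sums and no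
  integrability condition on \<open>\<phi>\<close> or \<open>g\<close> arises.\<close>

lemma expectation_Markov:
  fixes \<phi> :: "config list \<Rightarrow> real" and g :: "config \<Rightarrow> real"
  shows "expectation (\<lambda>\<omega>. \<phi> (history C n \<omega>) * g (C (Suc n) \<omega>)) =
    expectation (\<lambda>\<omega>. \<phi> (history C n \<omega>) * measure_pmf.expectation (lerrw_step (C n \<omega>)) g)"
proof -
  have "expectation (\<lambda>\<omega>. \<phi> (history C n \<omega>) * g (C (Suc n) \<omega>)) =
      measure_pmf.expectation (history_pmf (Suc n)) (\<lambda>l. \<phi> (tl l) * g (hd l))"
    unfolding expectation_history[symmetric] by simp
  also have "\<dots> = measure_pmf.expectation (history_pmf n)
      (\<lambda>l. \<phi> l * measure_pmf.expectation (lerrw_step (hd l)) g)"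
    by (simp add: expectation_bind_pmf_finite finite_set_history_pmf finite_set_lerrw_step)
  also have "\<dots> = expectation (\<lambda>\<omega>. \<phi> (history C n \<omega>) *
      measure_pmf.expectation (lerrw_step (C n \<omega>)) g)"
    unfolding expectation_history[symmetric] by simp
  finally show ?thesis .
qed

text \<open>Events of the past up to time \<open>n\<close>, described pathwise so that no generated sigma-algebra is needed.\<close>

definition known_at :: "nat \<Rightarrow> 'a set \<Rightarrow> bool" where
  "known_at n A \<longleftrightarrow> A \<subseteq> space M \<and>
    (\<forall>\<omega>\<in>space M. \<forall>\<omega>'\<in>space M. (\<forall>k\<le>n. C k \<omega> = C k \<omega>') \<longrightarrow> \<omega> \<in> A \<longrightarrow> \<omega>' \<in> A)"

text \<open>An event of the past is the preimage of its own image under \<open>history C n\<close>.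
  This makes it measurable and its indicator a function of the history.\<close>

lemma known_atD:
  assumes "known_at n A" "\<omega> \<in> space M"
  shows "\<omega> \<in> A \<longleftrightarrow> history C n \<omega> \<in> history C n ` A"
proof
  assume "history C n \<omega> \<in> history C n ` A"
  then obtain \<omega>' where \<omega>': "\<omega>' \<in> A" "\<forall>k\<le>n. C k \<omega>' = C k \<omega>"
    unfolding image_iff history_eq_iff by metis
  then show "\<omega> \<in> A"
    using assms unfolding known_at_def by blast
qed simp

lemma known_at_sets:
  assumes "known_at n A"
  shows "A \<in> events"
proof -
  have "A = {\<omega> \<in> space M. history C n \<omega> \<in> history C n ` A}"
    using assms known_atD[OF assms] unfolding known_at_def by blast
  also have "\<dots> \<in> events"
    by measurable
  finally show ?thesis .
qed

lemma known_at_Markov: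
  fixes g :: "config \<Rightarrow> real"
  assumes "known_at n A"
  shows "expectation (\<lambda>\<omega>. indicator A \<omega> * g (C (Suc n) \<omega>)) =
    expectation (\<lambda>\<omega>. indicator A \<omega> * measure_pmf.expectation (lerrw_step (C n \<omega>)) g)"
proof -
  have *: "indicator A \<omega> = (indicator (history C n ` A) (history C n \<omega>) :: real)" if "\<omega> \<in> space M" for \<omega>
    using known_atD[OF assms that] by (simp add: indicator_def)
  show ?thesis
    using expectation_Markov[of "indicator (history C n ` A)" n g]
    by (simp add: * cong: Bochner_Integration.integral_cong)
qed

section \<open>Meeting times are almost surely finite\<close>

definition walkers_meet :: "config \<Rightarrow> bool" where
  "walkers_meet s \<longleftrightarrow> fst s = 0 \<and> fst (snd s) = 0"

lemma walkers_meet_C: "walkers_meet (C n \<omega>) \<longleftrightarrow> X1 n \<omega> = 0 \<and> X2 n \<omega> = 0"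
  by (simp add: walkers_meet_def lerrw_config_def)

text \<open>At an odd time exactly one walker is away: choosing it produces a meeting, choosing the
  other leaves both away.\<close>

lemma expectation_step_not_meet:
  assumes "walkers_invariant n s" "odd n"
  shows "measure_pmf.expectation (lerrw_step s) (\<lambda>s. of_bool (\<not> walkers_meet s)) = (1 / 2 :: real)"
proof -
  obtain x1 x2 a b where s: "s = (x1, x2, a, b)"
    by (cases s)
  show ?thesis
    using assms unfolding s expectation_lerrw_step
    by (auto simp: expectation_walker_move walkers_meet_def)
qed

definition apart_between :: "nat \<Rightarrow> nat \<Rightarrow> 'a set" where
  "apart_between i j = {\<omega> \<in> space M. \<forall>k<j. \<not> walkers_meet (C (2 * (i + k) + 2) \<omega>)}"

text \<open>The index is odd so that one Markov step from it lands on
  \<open>2 * (i + j) + 2\<close>, the next even time to be added.\<close>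

lemma known_at_apart_between: "known_at (2 * (i + j) + 1) (apart_between i j)"
  unfolding known_at_def
proof (intro conjI ballI impI)
  fix \<omega> \<omega>' assume *: "\<omega>' \<in> space M" "\<forall>k\<le>2 * (i + j) + 1. C k \<omega> = C k \<omega>'" "\<omega> \<in> apart_between i j"
  have "C (2 * (i + k) + 2) \<omega> = C (2 * (i + k) + 2) \<omega>'" if "k < j" for k
    using that by (intro *(2)[rule_format]) simp
  with * show "\<omega>' \<in> apart_between i j"
    by (simp add: apart_between_def)
qed (auto simp: apart_between_def)

lemma prob_apart_between: "prob (apart_between i j) = (1 / 2) ^ j"
proof (induction j)
  case 0
  then show ?case
    by (simp add: apart_between_def prob_space)
next
  case (Suc j)
  let ?n = "2 * (i + j) + 1"
  note known_at_sets[OF known_at_apart_between, measurable]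
  have "prob (apart_between i (Suc j)) = expectation (indicator (apart_between i (Suc j)))"
    by simp
  also have "\<dots> = expectation (\<lambda>\<omega>. indicator (apart_between i j) \<omega> * of_bool (\<not> walkers_meet (C (Suc ?n) \<omega>)))"
  proof (intro Bochner_Integration.integral_cong refl)
    fix \<omega>
    have "\<omega> \<in> apart_between i (Suc j) \<longleftrightarrow>
        \<omega> \<in> apart_between i j \<and> \<not> walkers_meet (C (Suc ?n) \<omega>)"
      unfolding apart_between_def All_less_Suc by (simp add: conj_ac)
    then show "indicator (apart_between i (Suc j)) \<omega> =
        indicator (apart_between i j) \<omega> * (of_bool (\<not> walkers_meet (C (Suc ?n) \<omega>)) :: real)"
      by (simp only: indicator_def) simp
  qed
  also have "\<dots> = expectation (\<lambda>\<omega>. indicator (apart_between i j) \<omega> *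
      measure_pmf.expectation (lerrw_step (C ?n \<omega>)) (\<lambda>s. of_bool (\<not> walkers_meet s)))"
    by (rule known_at_Markov[OF known_at_apart_between])
  also have "\<dots> = expectation (\<lambda>\<omega>. indicator (apart_between i j) \<omega> * (1 / 2))"
  proof (intro integral_cong_AE)
    show "AE \<omega> in M. indicator (apart_between i j) \<omega> * measure_pmf.expectation (lerrw_step (C ?n \<omega>))
        (\<lambda>s. of_bool (\<not> walkers_meet s)) = indicator (apart_between i j) \<omega> * (1 / 2 :: real)"
      using AE_invariant[of ?n] by eventually_elim (simp add: expectation_step_not_meet)
  qed measurable
  finally show ?case
    using Suc by simp
qed

lemma AE_infinitely_many_meetings: "AE \<omega> in M. \<forall>k. \<exists>j>k. X1 j \<omega> = 0 \<and> X2 j \<omega> = 0"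
proof -
  have "AE \<omega> in M. \<exists>k. walkers_meet (C (2 * (i + k) + 2) \<omega>)" for i
  proof -
    let ?N = "{\<omega> \<in> space M. \<forall>k. \<not> walkers_meet (C (2 * (i + k) + 2) \<omega>)}"
    have N: "?N \<in> events"
      by measurable
    \<comment> \<open>Never meeting after time \<open>2 * i\<close> at an even time is contained in
      every \<open>apart_between i j\<close>.\<close>
    have "prob ?N \<le> (1 / 2) ^ j" for j
      unfolding prob_apart_between[of i, symmetric]
      by (intro finite_measure_mono known_at_sets[OF known_at_apart_between])
        (auto simp: apart_between_def)
    then have "prob ?N \<le> 0"
      by (intro LIMSEQ_le_const[OF LIMSEQ_power_zero[of "1 / 2 :: real"]] exI allI impI) simp_all
    then have "emeasure M ?N = 0"
      unfolding emeasure_eq_measure measure_le_0_iff by (simp only: ennreal_0)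
    with N show ?thesis
      by (intro AE_I[where N = ?N]) blast+
  qed
  then have "AE \<omega> in M. \<forall>i. \<exists>k. walkers_meet (C (2 * (i + k) + 2) \<omega>)"
    by (simp add: AE_all_countable)
  then show ?thesis
  proof eventually_elim
    case (elim \<omega>)
    show ?case
    proof
      fix i
      from elim obtain k where "walkers_meet (C (2 * (i + k) + 2) \<omega>)"
        by blast
      then show "\<exists>j>i. X1 j \<omega> = 0 \<and> X2 j \<omega> = 0"
        unfolding walkers_meet_C by (intro exI[of _ "2 * (i + k) + 2"]) simp
    qed
  qed
qed

section \<open>The martingale property\<close>

abbreviation "\<tau> \<equiv> meeting_time X1 X2"
abbreviation "Y \<equiv> left_fraction_at_meeting X1 X2 w"
abbreviation "F \<equiv> natural_filtration M Y"

lemma meeting_time_C_cong: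
  assumes "\<And>k. k \<le> n \<Longrightarrow> C k \<omega> = C k \<omega>'" "\<tau> m \<omega> \<le> enat n"
  shows "\<tau> m \<omega>' = \<tau> m \<omega>" "Y m \<omega>' = Y m \<omega>"
proof -
  obtain t where t: "\<tau> m \<omega> = enat t" "t \<le> n"
    using assms(2) by (cases "\<tau> m \<omega>") auto
  have "X1 k \<omega> = X1 k \<omega>' \<and> X2 k \<omega> = X2 k \<omega>'" if "k \<le> n" for k
    using assms(1)[OF that] by (simp add: lerrw_config_def)
  from meeting_time_cong[OF t this] have "\<tau> m \<omega>' = enat t"
    by blast
  then show "\<tau> m \<omega>' = \<tau> m \<omega>" "Y m \<omega>' = Y m \<omega>"
    using t assms(1)[of t] by (simp_all add: left_fraction_at_meeting_def lerrw_config_def)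
qed

lemma known_at_meeting_le:
  assumes "k \<le> n"
  shows "known_at n {\<omega> \<in> space M. \<tau> m \<omega> \<le> enat k}"
  unfolding known_at_def
proof (intro conjI ballI impI)
  fix \<omega> \<omega>' assume *: "\<omega>' \<in> space M" "\<forall>k\<le>n. C k \<omega> = C k \<omega>'" "\<omega> \<in> {\<omega> \<in> space M. \<tau> m \<omega> \<le> enat k}"
  have "\<tau> m \<omega> \<le> enat k"
    using *(3) by simp
  also have "enat k \<le> enat n"
    using assms by simp
  finally have "\<tau> m \<omega>' = \<tau> m \<omega>"
    using *(2) by (intro meeting_time_C_cong(1)[of n]) auto
  with * show "\<omega>' \<in> {\<omega> \<in> space M. \<tau> m \<omega> \<le> enat k}"
    by simp
qed auto

lemma known_at_Diff:
  assumes "known_at n A" "known_at n B"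
  shows "known_at n (A - B)"
  unfolding known_at_def
proof (intro conjI ballI impI)
  fix \<omega> \<omega>' assume *: "\<omega> \<in> space M" "\<omega>' \<in> space M" "\<forall>k\<le>n. C k \<omega> = C k \<omega>'" "\<omega> \<in> A - B"
  have "\<omega>' \<in> A"
    using assms(1) * unfolding known_at_def by blast
  moreover have "\<omega> \<in> B" if "\<omega>' \<in> B"
  proof -
    have "\<forall>k\<le>n. C k \<omega>' = C k \<omega>"
      using *(3) by simp
    with that show ?thesis
      using assms(2) *(1,2) unfolding known_at_def by blast
  qed
  ultimately show "\<omega>' \<in> A - B"
    using *(4) by blast
qed (use assms in \<open>auto simp: known_at_def\<close>)

section \<open>Measurability and integrability of the fraction at meetings\<close>

lemma measurable_meeting_time [measurable]: "\<tau> m \<in> M \<rightarrow>\<^sub>M count_space UNIV"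
proof -
  have [measurable]: "{\<omega> \<in> space M. \<tau> m \<omega> \<le> enat t} \<in> events" for t
    by (rule known_at_sets[OF known_at_meeting_le[OF order_refl]])
  \<comment> \<open>An extended natural number is determined by its finite upper bounds, infinity
    having none.\<close>
  have eq: "\<tau> m \<omega> = a \<longleftrightarrow> (\<forall>t. (\<tau> m \<omega> \<le> enat t) = (a \<le> enat t))" for a \<omega>
  proof
    assume *: "\<forall>t. (\<tau> m \<omega> \<le> enat t) = (a \<le> enat t)"
    show "\<tau> m \<omega> = a"
    proof (cases a)
      case (enat t)
      then obtain u where u: "\<tau> m \<omega> = enat u"
        using * by (cases "\<tau> m \<omega>") auto
      show ?thesis
        using spec[OF *, of t] spec[OF *, of u] unfolding u enat by simp
    next
      case infinity
      then show ?thesis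
        using * by (cases "\<tau> m \<omega>") auto
    qed
  qed simp
  have "\<tau> m -` {a} \<inter> space M = {\<omega> \<in> space M. \<forall>t. (\<tau> m \<omega> \<le> enat t) = (a \<le> enat t)}" for a
    unfolding eq[symmetric] by auto
  then show ?thesis
    unfolding measurable_count_space_eq2_countable by simp
qed

lemma measurable_Y [measurable]: "Y m \<in> borel_measurable M"
proof -
  have "(\<lambda>\<omega>. (\<lambda>i \<omega>. case i of enat t \<Rightarrow> (\<lambda>(x1, x2, a, b). real a / (real a + real b)) (C t \<omega>)
      | \<infinity> \<Rightarrow> 0) (\<tau> m \<omega>) \<omega>) \<in> borel_measurable M"
  proof (rule measurable_compose_countable)
    show "(\<lambda>\<omega>. case i of enat t \<Rightarrow> (\<lambda>(x1, x2, a, b). real a / (real a + real b)) (C t \<omega>)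
      | \<infinity> \<Rightarrow> 0) \<in> borel_measurable M" for i
      by (cases i) (auto intro: measurable_compose[OF measurable_C])
  qed measurable
  moreover have "Y m = (\<lambda>\<omega>. (\<lambda>i \<omega>. case i of
      enat t \<Rightarrow> (\<lambda>(x1, x2, a, b). real a / (real a + real b)) (C t \<omega>)
      | \<infinity> \<Rightarrow> 0) (\<tau> m \<omega>) \<omega>)"
    by (rule ext) (simp add: left_fraction_at_meeting_def lerrw_config_def split: enat.split)
  ultimately show ?thesis
    by simp
qed

lemma integrable_Y: "integrable M (Y m)"
proof (rule integrable_const_bound[where B = 1])
  show "AE \<omega> in M. norm (Y m \<omega>) \<le> 1"
    by (auto simp: left_fraction_at_meeting_def divide_le_eq_1 less_le split: enat.split)
qed measurable

section \<open>The natural filtration and the past up to a meeting\<close>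

lemma space_F: "space (F n) = space M"
  by (simp add: natural_filtration_def space_measure_of_conv)

lemma sets_F: "sets (F n) = sigma_sets (space M) {Y i -` B \<inter> space M | i B. i \<le> n \<and> B \<in> sets borel}"
  unfolding natural_filtration_def by (rule sets_measure_of) auto

lemma subalgebra_F: "subalgebra M (F n)"
proof -
  have "{Y i -` B \<inter> space M | i B. i \<le> n \<and> B \<in> sets borel} \<subseteq> events"
    using measurable_sets[OF measurable_Y] by blast
  then show ?thesis
    unfolding subalgebra_def space_F sets_F by (simp add: sets.sigma_sets_subset)
qed

text \<open>\<open>F m\<close> is contained in the sigma-algebra of the stopping time
  \<open>\<tau> m\<close>. For a generator with \<open>i \<le> m\<close>, the value
  \<open>Y i\<close> is settled by time \<open>k\<close> because
  \<open>\<tau> i \<le> \<tau> m \<le> k\<close>; complements are taken relative to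
  \<open>\<tau> m \<le> k\<close>.\<close>

lemma known_at_F:
  assumes "A \<in> sets (F m)"
  shows "known_at k (A \<inter> {\<omega> \<in> space M. \<tau> m \<omega> \<le> enat k})"
  using assms unfolding sets_F
proof (induction rule: sigma_sets.induct)
  case (Basic A)
  then obtain i B where A: "A = Y i -` B \<inter> space M" "i \<le> m"
    by blast
  have *: "\<tau> i \<omega> \<le> enat k" if "\<tau> m \<omega> \<le> enat k" for \<omega>
    using meeting_time_mono[OF A(2)] that by (rule order_trans)
  show ?case
    unfolding known_at_def
  proof (intro conjI ballI impI)
    fix \<omega> \<omega>' assume **: "\<omega>' \<in> space M" "\<forall>j\<le>k. C j \<omega> = C j \<omega>'"
      "\<omega> \<in> A \<inter> {\<omega> \<in> space M. \<tau> m \<omega> \<le> enat k}"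
    then show "\<omega>' \<in> A \<inter> {\<omega> \<in> space M. \<tau> m \<omega> \<le> enat k}"
      using meeting_time_C_cong[of k \<omega> \<omega>'] * by (auto simp: A)
  qed auto
next
  case (Compl A)
  have "(space M - A) \<inter> {\<omega> \<in> space M. \<tau> m \<omega> \<le> enat k} =
      {\<omega> \<in> space M. \<tau> m \<omega> \<le> enat k} - A \<inter> {\<omega> \<in> space M. \<tau> m \<omega> \<le> enat k}"
    by auto
  then show ?case
    using known_at_Diff[OF known_at_meeting_le[OF order_refl] Compl.IH] by simp
next
  case (Union A)
  have "known_at k (\<Union>i. A i \<inter> {\<omega> \<in> space M. \<tau> m \<omega> \<le> enat k})"
    using Union.IH unfolding known_at_def by blast
  then show ?case
    by simp
qed (simp add: known_at_def)

text \<open>Harmonicity makes \<open>meeting_value\<close> along the process a martingale, here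
  tested against events of the past.\<close>

lemma expectation_meeting_value_increment:
  assumes "known_at k D"
  shows "expectation (\<lambda>\<omega>. indicator D \<omega> * (meeting_value (C (Suc k) \<omega>) - meeting_value (C k \<omega>))) = 0"
proof -
  note [measurable] = known_at_sets[OF assms]
  have int: "integrable M (\<lambda>\<omega>. indicator D \<omega> * meeting_value (C j \<omega>))" for j
    using meeting_value_bounded
    by (intro integrable_const_bound[where B = 3]) (auto simp: indicator_def)
  have "expectation (\<lambda>\<omega>. indicator D \<omega> * meeting_value (C (Suc k) \<omega>)) =
      expectation (\<lambda>\<omega>. indicator D \<omega> * measure_pmf.expectation (lerrw_step (C k \<omega>)) meeting_value)"
    by (rule known_at_Markov[OF assms])
  also have "\<dots> = expectation (\<lambda>\<omega>. indicator D \<omega> * meeting_value (C k \<omega>))"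
  proof (intro integral_cong_AE)
    show "AE \<omega> in M. indicator D \<omega> * measure_pmf.expectation (lerrw_step (C k \<omega>)) meeting_value =
        indicator D \<omega> * meeting_value (C k \<omega>)"
      using AE_invariant[of k]
    proof eventually_elim
      case (elim \<omega>)
      then show ?case
        by (cases "C k \<omega>") (simp only: walkers_invariant.simps meeting_value_harmonic)
    qed
  qed measurable
  finally show ?thesis
    using int by (simp add: right_diff_distrib)
qed

lemma AE_meetings:
  "AE \<omega> in M. \<forall>n. \<exists>t. \<tau> n \<omega> = enat t \<and> Y n \<omega> = meeting_value (C t \<omega>)"
  using AE_infinitely_many_meetings initial_config
proof eventually_elim
  case (elim \<omega>)
  show ?case
  proof
    fix n
    obtain t where t: "\<tau> n \<omega> = enat t"
      using meeting_time_finite[of X1 \<omega> X2 n] elim(1) by auto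
    then have "X1 t \<omega> = 0 \<and> X2 t \<omega> = 0"
      using elim(2) by (intro meeting_time_meets[of X1 X2 n \<omega>]) (auto simp: lerrw_config_def)
    then show "\<exists>t. \<tau> n \<omega> = enat t \<and> Y n \<omega> = meeting_value (C t \<omega>)"
      using t by (simp add: left_fraction_at_meeting_def lerrw_config_def)
  qed
qed

lemma set_integral_Y:
  assumes "m \<le> n" "A \<in> sets (F m)"
  shows "(\<integral>\<omega>\<in>A. Y n \<omega> \<partial>M) = (\<integral>\<omega>\<in>A. Y m \<omega> \<partial>M)"
proof -
  \<comment> \<open>On \<open>D k\<close> the increment after time \<open>k\<close> counts:
    \<open>A\<close> holds and \<open>\<tau> m \<le> k < \<tau> n\<close>. Both conditions are
    decided by time \<open>k\<close>, so each increment has mean 0.\<close>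
  define D where "D k = A \<inter> {\<omega> \<in> space M. \<tau> m \<omega> \<le> enat k} - {\<omega> \<in> space M. \<tau> n \<omega> \<le> enat k}" for k
  have D: "known_at k (D k)" for k
    unfolding D_def by (intro known_at_Diff known_at_F assms known_at_meeting_le) simp
  note [measurable] = known_at_sets[OF D]
  have A [measurable]: "A \<in> events"
    using assms(2) subalgebra_F by (auto simp: subalgebra_def)
  define S where "S k \<omega> = (\<Sum>i<k. indicator (D i) \<omega> *
    (meeting_value (C (Suc i) \<omega>) - meeting_value (C i \<omega>)))" for k \<omega>
  have "integrable M (\<lambda>\<omega>. indicator (D i) \<omega> * (meeting_value (C (Suc i) \<omega>) - meeting_value (C i \<omega>)))"
    for i
  proof (rule integrable_const_bound[where B = 6])
    have "\<bar>meeting_value (C (Suc i) \<omega>) - meeting_value (C i \<omega>)\<bar> \<le> 6" for \<omega>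
      using meeting_value_bounded[of "C (Suc i) \<omega>"] meeting_value_bounded[of "C i \<omega>"] by linarith
    then show "AE \<omega> in M. norm (indicator (D i) \<omega> *
        (meeting_value (C (Suc i) \<omega>) - meeting_value (C i \<omega>))) \<le> 6"
      by (simp add: indicator_def)
  qed measurable
  then have "expectation (S k) = (\<Sum>i<k. expectation (\<lambda>\<omega>. indicator (D i) \<omega> *
      (meeting_value (C (Suc i) \<omega>) - meeting_value (C i \<omega>))))" for k
    unfolding S_def[abs_def] by (rule Bochner_Integration.integral_sum)
  then have S0: "expectation (S k) = 0" for k
    by (simp only: expectation_meeting_value_increment[OF D] sum.neutral_const)
  have S: "AE \<omega> in M. (\<lambda>k. S k \<omega>) \<longlonglongrightarrow> indicator A \<omega> * (Y n \<omega> - Y m \<omega>) \<and> (\<forall>k. norm (S k \<omega>) \<le> 6)"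
    using AE_meetings AE_space
  proof eventually_elim
    case (elim \<omega>)
    obtain s where s: "\<tau> m \<omega> = enat s" "Y m \<omega> = meeting_value (C s \<omega>)"
      using elim(1) by blast
    obtain t where t: "\<tau> n \<omega> = enat t" "Y n \<omega> = meeting_value (C t \<omega>)"
      using elim(1) by blast
    have "s \<le> t"
      using meeting_time_mono[OF assms(1), of X1 X2 \<omega>] s t by simp
    \<comment> \<open>The sum telescopes over \<open>s \<le> i < min t k\<close> and is empty for
      \<open>k < s\<close>.\<close>
    have eq: "S k \<omega> = indicator A \<omega> *
        (if s \<le> k then meeting_value (C (min t k) \<omega>) - meeting_value (C s \<omega>) else 0)" for k
    proof -
      have "S k \<omega> = (\<Sum>i<k. indicator {s..<min t k} i *
          (indicator A \<omega> * (meeting_value (C (Suc i) \<omega>) - meeting_value (C i \<omega>))))"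
        unfolding S_def using elim(2) s t
        by (intro sum.cong) (auto simp: D_def indicator_def)
      also have "\<dots> = (\<Sum>i=s..<min t k.
          indicator A \<omega> * (meeting_value (C (Suc i) \<omega>) - meeting_value (C i \<omega>)))"
        by (intro sum.mono_neutral_cong_right) (auto simp: indicator_def)
      also have "\<dots> = indicator A \<omega> *
          (if s \<le> k then meeting_value (C (min t k) \<omega>) - meeting_value (C s \<omega>) else 0)"
        using \<open>s \<le> t\<close> sum_Suc_diff'[of s "min t k" "\<lambda>i. meeting_value (C i \<omega>)"]
        by (simp add: sum_distrib_left[symmetric])
      finally show ?thesis .
    qed
    have "eventually (\<lambda>k. S k \<omega> = indicator A \<omega> * (Y n \<omega> - Y m \<omega>)) sequentially"
    proof (rule eventually_mono[OF eventually_ge_at_top[of t]])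
      show "S k \<omega> = indicator A \<omega> * (Y n \<omega> - Y m \<omega>)" if "t \<le> k" for k
        using that \<open>s \<le> t\<close> by (simp add: eq s t min_absorb1)
    qed
    then have "(\<lambda>k. S k \<omega>) \<longlonglongrightarrow> indicator A \<omega> * (Y n \<omega> - Y m \<omega>)"
      by (rule tendsto_eventually)
    moreover have "norm (S k \<omega>) \<le> 6" for k
      using meeting_value_bounded[of "C (min t k) \<omega>"] meeting_value_bounded[of "C s \<omega>"]
      unfolding eq by (simp add: indicator_def) linarith
    ultimately show ?case
      by blast
  qed
  \<comment> \<open>The dominating constant 6 is twice the bound 3 of \<open>meeting_value\<close>,
    since \<open>S k\<close> is 0 or a difference of two of its values.\<close>
  have "(\<lambda>k. expectation (S k)) \<longlonglongrightarrow> expectation (\<lambda>\<omega>. indicator A \<omega> * (Y n \<omega> - Y m \<omega>))"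
  proof (rule integral_dominated_convergence[where w = "\<lambda>_. 6"])
    show "S k \<in> borel_measurable M" for k
      unfolding S_def[abs_def] by measurable
  qed (use S in auto)
  then have "expectation (\<lambda>\<omega>. indicator A \<omega> * (Y n \<omega> - Y m \<omega>)) = 0"
    unfolding S0 by (simp add: LIMSEQ_const_iff)
  moreover have "integrable M (\<lambda>\<omega>. indicator A \<omega> * Y j \<omega>)" for j
    using integrable_mult_indicator[OF A integrable_Y[of j]] by simp
  ultimately show ?thesis
    by (simp add: set_lebesgue_integral_def right_diff_distrib)
qed

lemma martingale_Y: "martingale M Y"
  unfolding martingale_def martingale_wrt_def
proof (intro conjI allI impI)
  show "filtration (space M) F"
  proof
    show "sets (F i) \<subseteq> sets (F j)" if "i \<le> j" for i j
      unfolding sets_F using that by (intro sigma_sets_mono') (blast intro: order_trans)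
  qed (rule space_F)
  show "subalgebra M (F n)" for n
    by (rule subalgebra_F)
  show Y: "Y n \<in> borel_measurable (F n)" for n
    by (rule measurableI) (auto simp: space_F sets_F intro!: sigma_sets.Basic)
  show "integrable M (Y n)" for n
    by (rule integrable_Y)
  fix m n :: nat
  assume "m \<le> n"
  interpret finite_measure_subalgebra M "F m"
    by unfold_locales (rule subalgebra_F)
  \<comment> \<open>The conditional expectation is characterised by its integrals over the events of
    \<open>F m\<close>, which \<open>set_integral_Y\<close> compares.\<close>
  show "AE \<omega> in M. real_cond_exp M (F m) (Y n) \<omega> = Y m \<omega>"
    by (intro real_cond_exp_charact set_integral_Y integrable_Y Y \<open>m \<le> n\<close>)
qed

end

theorem lemma5p7:
  fixes M :: "'a measure"
    and X1 X2 :: "nat \<Rightarrow> 'a \<Rightarrow> int"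
    and w :: "nat \<Rightarrow> nat \<Rightarrow> 'a \<Rightarrow> nat"
  assumes "two_walker_lerrw M X1 X2 w"
  shows "martingale M (left_fraction_at_meeting X1 X2 w)"
  using assms by (rule two_walker_lerrw.martingale_Y)

end
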